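(* Let $M\ge 1$, let $\mu_1,\dots,\mu_M\in\mathbb{R}$, $\sigma_1,\dots,\sigma_M>0$, $P_i=\mathcal N(\mu_i,\sigma_i^2)$, $P_{\mathrm{ens}}=\frac1M\sum_{i=1}^M P_i$ and $P_*=\mathcal N(\mu_*,\sigma_*^2)$, where $\mu_*=\frac1M\sum_{i=1}^M\mu_i$ and $\sigma_*^2=\frac1M\sum_{i=1}^M(\sigma_i^2+\mu_i^2)-\mu_*^2$. Let $H$ and $d$ be the entropy and divergence functions of the continuous ranked probability score (CRPS). Put $A(\mu,\sigma)=2\sigma\,\phi(\mu/\sigma)+\mu\,[2\Phi(\mu/\sigma)-1]$, with $\phi,\Phi$ the standard normal density and distribution function, $\mu_{ij}=\mu_i-\mu_j$, $\sigma_{ij}=\sqrt{\sigma_i^2+\sigma_j^2}$, $\mu_{*j}=\mu_*-\mu_j$, $\sigma_{*j}=\sqrt{\sigma_*^2+\sigma_j^2}$. Then the following hold. Bayes risks: $$\frac1M\sum_{i=1}^M H(P_i)=\frac{1}{M\sqrt\pi}\sum_{i=1}^M\sigma_i,\qquad H(P_{\mathrm{ens}})=\frac{1}{2M^2}\sum_{i=1}^M\sum_{j=1}^M A(\mu_{ij},\sigma_{ij}),\qquad H(P_* )=\sqrt{\frac{\sigma_*^2}{\pi}}.$$ Excess risks: $$\frac1{M^2}\sum_{i=1}^M\sum_{j=1}^M d(P_i,P_j)=\frac1{M^2}\sum_{i=1}^M\sum_{j=1}^M\Big[A(\mu_{ij},\sigma_{ij})-\frac{\sigma_i+\sigma_j}{\sqrt\pi}\Big],$$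 $$\frac1M\sum_{i=1}^M d(P_{\mathrm{ens}},P_i)=\frac1M\sum_{i=1}^M d(P_i,P_{\mathrm{ens}})=\frac1{2M^2}\sum_{i=1}^M\sum_{j=1}^M A(\mu_{ij},\sigma_{ij})-\frac1M\sum_{i=1}^M\frac{\sigma_i}{\sqrt\pi},$$ $$\frac1M\sum_{j=1}^M d(P_*,P_j)=\frac1M\sum_{j=1}^M d(P_j,P_* )=\frac1M\sum_{j=1}^M\Big[A(\mu_{*j},\sigma_{*j})-\frac{\sigma_*+\sigma_j}{\sqrt\pi}\Big],$$ $$d(P_*,P_{\mathrm{ens}})=d(P_{\mathrm{ens}},P_* )=\frac1M\sum_{j=1}^M A(\mu_{*j},\sigma_{*j})-\frac{\sigma_*}{\sqrt\pi}-H(P_{\mathrm{ens}}).$$ In particular, $2\cdot\frac1M\sum_{i=1}^M d(P_{\mathrm{ens}},P_i)=\frac1{M^2}\sum_{i=1}^M\sum_{j=1}^M d(P_i,P_j)$.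
   Context: For a probability measure $P$ on $\mathbb{R}$ with distribution function $F_P$ and finite first moment, and $y\in\mathbb{R}$, the continuous ranked probability score is $\mathrm{CRPS}(P,y)=\int_{\mathbb{R}}\big(F_P(t)-\mathbf 1\{y\le t\}\big)^2\,dt$. For probability measures $P,Q$ the expected score is $S(P,Q)=\int \mathrm{CRPS}(P,y)\,dQ(y)$. The entropy function is $H(P)=S(P,P)$ and the divergence function is $d(P,Q)=S(P,Q)-H(Q)$ (first argument: prediction; second argument: true distribution). $\mathcal N(\mu,\sigma^2)$ is the Gaussian with mean $\mu$ and variance $\sigma^2$; $P_{\mathrm{ens}}$ is the equally weighted Gaussian mixture, whose mean and variance are $\mu_*$ and $\sigma_*^2$. *)

theory Defs
  imports "HOL-Probability.Probability"
begin

(* The integrals below are Bochner integrals, hence 0 for a non-integrable integrand. When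
   P and Q have finite first moment, as Gaussians and their mixtures do, both integrands are
   integrable. *)
definition crps :: "real measure \<Rightarrow> real \<Rightarrow> real" where
  "crps P y = (\<integral>t. (cdf P t - indicator {y..} t)\<^sup>2 \<partial>lborel)"

definition crps_score :: "real measure \<Rightarrow> real measure \<Rightarrow> real" where
  "crps_score P Q = (\<integral>y. crps P y \<partial>Q)"

definition crps_entropy :: "real measure \<Rightarrow> real" where
  "crps_entropy P = crps_score P P"

(* first argument: prediction; second argument: true distribution *)
definition crps_div :: "real measure \<Rightarrow> real measure \<Rightarrow> real" where
  "crps_div P Q = crps_score P Q - crps_entropy Q"

(* The second parameter is the variance, whereas that of normal_density is the
   standard deviation. *)
definition gaussian :: "real \<Rightarrow> real \<Rightarrow> real measure" where
  "gaussian m v = density lborel (\<lambda>x. ennreal (normal_density m (sqrt v) x))"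

definition mixture :: "nat \<Rightarrow> (nat \<Rightarrow> real measure) \<Rightarrow> real measure" where
  "mixture M P = measure_of UNIV (sets borel) (\<lambda>A. (\<Sum>i=1..M. emeasure (P i) A) / of_nat M)"

definition A_crps :: "real \<Rightarrow> real \<Rightarrow> real" where
  "A_crps m s = 2 * s * std_normal_density (m / s) + m * (2 * cdf std_normal_distribution (m / s) - 1)"

lemma sets_gaussian [simp, measurable_cong]: "sets (gaussian m v) = sets borel"
  by (simp add: gaussian_def)

lemma real_distribution_gaussian:
  assumes "v > 0" shows "real_distribution (gaussian m v)"
proof -
  interpret prob_space "gaussian m v"
    unfolding gaussian_def using assms by (intro prob_space_normal_density) simp
  show ?thesis by unfold_locales simp
qed

lemma sets_mixture [simp, measurable_cong]: "sets (mixture M P) = sets borel"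
  unfolding mixture_def by (metis sets.sets_measure_of_eq space_borel)

(* measure_of yields the null measure unless its argument is countably additive;
   here it always is. *)
lemma emeasure_mixture:
  assumes "\<And>i. i \<in> {1..M} \<Longrightarrow> sets (P i) = sets borel" and B: "B \<in> sets borel"
  shows "emeasure (mixture M P) B = (\<Sum>i=1..M. emeasure (P i) B) / of_nat M"
proof (rule emeasure_measure_of[OF mixture_def])
  show "sets borel \<subseteq> Pow (UNIV :: real set)" by simp
  show "B \<in> sets (mixture M P)" using B by simp
  show "positive (sets (mixture M P)) (\<lambda>A. (\<Sum>i=1..M. emeasure (P i) A) / of_nat M)"
    by (simp add: positive_def)
  show "countably_additive (sets (mixture M P)) (\<lambda>A. (\<Sum>i=1..M. emeasure (P i) A) / of_nat M)"
  proof (rule countably_additiveI)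
    fix A :: "nat \<Rightarrow> real set"
    assume A: "range A \<subseteq> sets (mixture M P)" "disjoint_family A"
    have "(\<Sum>n. (\<Sum>i=1..M. emeasure (P i) (A n)) / of_nat M)
        = (\<Sum>n. \<Sum>i=1..M. emeasure (P i) (A n)) / of_nat M"
      by (simp add: divide_ennreal_def)
    also have "(\<Sum>n. \<Sum>i=1..M. emeasure (P i) (A n)) = (\<Sum>i=1..M. \<Sum>n. emeasure (P i) (A n))"
      by (rule suminf_sum) simp
    also have "\<dots> = (\<Sum>i=1..M. emeasure (P i) (\<Union>n. A n))"
      using A assms(1) by (intro sum.cong refl suminf_emeasure) auto
    finally show "(\<Sum>n. (\<Sum>i=1..M. emeasure (P i) (A n)) / of_nat M)
        = (\<Sum>i=1..M. emeasure (P i) (\<Union>n. A n)) / of_nat M" .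
  qed
qed

lemma real_distribution_mixture:
  assumes "M \<ge> 1" and P: "\<And>i. i \<in> {1..M} \<Longrightarrow> real_distribution (P i)"
  shows "real_distribution (mixture M P)"
proof -
  have s: "sets (P i) = sets borel" and u: "emeasure (P i) UNIV = 1" if "i \<in> {1..M}" for i
  proof -
    interpret real_distribution "P i" by (rule P[OF that])
    show "sets (P i) = sets borel" by simp
    show "emeasure (P i) UNIV = 1" using emeasure_space_1 by simp
  qed
  have sp: "space (mixture M P) = UNIV"
    using sets_eq_imp_space_eq[OF sets_mixture] by simp
  have "emeasure (mixture M P) UNIV = (\<Sum>i=1..M. 1) / of_nat M"
    using s u by (subst emeasure_mixture) auto
  also have "\<dots> = 1"
    using \<open>M \<ge> 1\<close> by (simp add: ennreal_divide_self of_nat_less_top less_imp_neq)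
  finally have "prob_space (mixture M P)"
    by (intro prob_spaceI) (simp add: sp)
  then show ?thesis
    by (intro real_distribution.intro) (simp_all add: real_distribution_axioms_def)
qed

end

theory Submission
  imports Defs
begin

text \<open>The identity \<open>(F - I)\<^sup>2 = [F (1 - I) + I (1 - F)] - F (1 - F)\<close>, with \<open>F = F\<^sub>P(t)\<close>
  and \<open>I\<close> the indicator of \<open>y \<le> t\<close>, together with Fubini gives
  \<open>S(P,Q) = E|X - Y| - E|X - X'| / 2\<close> for independent \<open>X, X' \<sim> P\<close> and \<open>Y \<sim> Q\<close>, so the
  divergence is symmetric. The mean absolute difference \<open>E|X - Y| = \<integral> F\<^sub>P (1 - F\<^sub>Q) + F\<^sub>Q (1 - F\<^sub>P)\<close>
  is affine in the distribution function of \<open>X\<close>, which handles mixtures, and for Gaussians \<open>X - Y\<close>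
  is Gaussian, with \<open>E|N(m,s\<^sup>2)| = A(m,s)\<close>.\<close>

section \<open>Mean absolute differences through distribution functions\<close>

text \<open>For independent \<open>X\<close> and \<open>Y\<close> with laws \<open>P\<close> and
  \<open>Q\<close>, this is the probability that exactly one of \<open>X \<le> t\<close> and
  \<open>Y \<le> t\<close> holds, that is, that \<open>t\<close> separates \<open>X\<close> from
  \<open>Y\<close>.\<close>

definition cdf_cross :: "real measure \<Rightarrow> real measure \<Rightarrow> real \<Rightarrow> real" where
  "cdf_cross P Q t = cdf P t * (1 - cdf Q t) + cdf Q t * (1 - cdf P t)"

text \<open>This is \<open>E|X - Y|\<close> when both first moments are finite. In this form
  symmetry is immediate and the effect of mixing is visible under the integral.\<close>

definition mean_abs_diff :: "real measure \<Rightarrow> real measure \<Rightarrow> real" where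
  "mean_abs_diff P Q = (\<integral>t. cdf_cross P Q t \<partial>lborel)"

lemma mean_abs_diff_commute: "mean_abs_diff P Q = mean_abs_diff Q P"
  by (simp add: mean_abs_diff_def cdf_cross_def add.commute)

lemma borel_measurable_cdf:
  assumes "real_distribution P" shows "cdf P \<in> borel_measurable borel"
proof -
  interpret real_distribution P by fact
  show ?thesis
    by (intro borel_measurable_mono monoI cdf_nondecreasing)
qed

lemma cdf_bounds:
  assumes "real_distribution P" shows "0 \<le> cdf P t" "cdf P t \<le> 1"
proof -
  interpret real_distribution P by fact
  show "0 \<le> cdf P t" by (rule cdf_nonneg)
  show "cdf P t \<le> 1" by (rule cdf_bounded_prob)
qed

lemma cdf_cross_nonneg:
  assumes "real_distribution P" "real_distribution Q"
  shows "0 \<le> cdf_cross P Q t"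
  using cdf_bounds[OF assms(1)] cdf_bounds[OF assms(2)] by (simp add: cdf_cross_def)

lemma borel_measurable_cdf_cross:
  assumes "real_distribution P" "real_distribution Q"
  shows "cdf_cross P Q \<in> borel_measurable borel"
  unfolding cdf_cross_def[abs_def]
  using borel_measurable_cdf[OF assms(1)] borel_measurable_cdf[OF assms(2)] by measurable

text \<open>The distance \<open>|x - y|\<close> is the length of the set of \<open>t\<close>
  separating \<open>x\<close> from \<open>y\<close>; two applications of Tonelli move the integral
  over \<open>t\<close> outside. Both sides may be infinite, so the identity carries finiteness in
  either direction.\<close>

lemma nn_integral_cdf_cross:
  assumes P: "real_distribution P" and Q: "real_distribution Q"
  shows "(\<integral>\<^sup>+t. cdf_cross P Q t \<partial>lborel) = (\<integral>\<^sup>+y. \<integral>\<^sup>+x. ennreal \<bar>x - y\<bar> \<partial>P \<partial>Q)"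
proof -
  interpret P: real_distribution P by fact
  interpret Q: real_distribution Q by fact
  interpret PL: pair_sigma_finite P lborel ..
  interpret QL: pair_sigma_finite Q lborel ..
  have sep: "emeasure R {..t} = ennreal (cdf R t)"
    "emeasure R {t<..} = ennreal (1 - cdf R t)" if "real_distribution R" for R t
  proof -
    interpret R: real_distribution R by fact
    show "emeasure R {..t} = ennreal (cdf R t)"
      by (simp add: R.emeasure_eq_measure cdf_def)
    have "R.prob (UNIV - {..t}) = 1 - R.prob {..t}"
      using R.prob_compl[of "{..t}"] by simp
    moreover have "UNIV - {..t} = {t<..}" by auto
    ultimately show "emeasure R {t<..} = ennreal (1 - cdf R t)"
      by (simp add: R.emeasure_eq_measure cdf_def)
  qed
  have "(\<integral>\<^sup>+y. \<integral>\<^sup>+x. ennreal \<bar>x - y\<bar> \<partial>P \<partial>Q)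
      = (\<integral>\<^sup>+y. \<integral>\<^sup>+x. \<integral>\<^sup>+t. indicator {t. (y \<le> t) \<noteq> (x \<le> t)} t \<partial>lborel \<partial>P \<partial>Q)"
  proof (intro nn_integral_cong)
    fix x y :: real
    \<comment> \<open>The two conditions differ exactly for
      \<open>min x y \<le> t < max x y\<close>, so the interval is half-open.\<close>
    have "{t. (y \<le> t) \<noteq> (x \<le> t)} = {min x y..<max x y}" by auto
    then show "ennreal \<bar>x - y\<bar> = (\<integral>\<^sup>+t. indicator {t. (y \<le> t) \<noteq> (x \<le> t)} t \<partial>lborel)"
      by (simp add: min_def max_def)
  qed
  also have "\<dots> = (\<integral>\<^sup>+y. \<integral>\<^sup>+t. \<integral>\<^sup>+x. indicator {t. (y \<le> t) \<noteq> (x \<le> t)} t \<partial>P \<partial>lborel \<partial>Q)"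
    by (intro nn_integral_cong PL.Fubini'[symmetric]) measurable
  \<comment> \<open>For fixed \<open>y\<close> and \<open>t\<close>, the point \<open>x\<close> has
    to lie on the other side of \<open>t\<close> than \<open>y\<close>.\<close>
  also have "\<dots> = (\<integral>\<^sup>+y. \<integral>\<^sup>+t. indicator {..t} y * ennreal (1 - cdf P t)
                        + indicator {t<..} y * ennreal (cdf P t) \<partial>lborel \<partial>Q)"
  proof (intro nn_integral_cong)
    fix y t :: real
    have "(\<integral>\<^sup>+x. indicator {t. (y \<le> t) \<noteq> (x \<le> t)} t \<partial>P)
        = (\<integral>\<^sup>+x. indicator (if y \<le> t then {t<..} else {..t}) x \<partial>P)"
      by (intro nn_integral_cong) (auto simp: indicator_def)
    also have "\<dots> = indicator {..t} y * ennreal (1 - cdf P t)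
                  + indicator {t<..} y * ennreal (cdf P t)"
      by (simp add: sep[OF P])
    finally show "(\<integral>\<^sup>+x. indicator {t. (y \<le> t) \<noteq> (x \<le> t)} t \<partial>P) = \<dots>" .
  qed
  also have "\<dots> = (\<integral>\<^sup>+t. \<integral>\<^sup>+y. indicator {..t} y * ennreal (1 - cdf P t)
                        + indicator {t<..} y * ennreal (cdf P t) \<partial>Q \<partial>lborel)"
  proof (intro QL.Fubini'[symmetric])
    note [measurable] = borel_measurable_cdf[OF P]
    \<comment> \<open>Joint measurability is shown for a case distinction on
      \<open>y \<le> t\<close>; the indicators, whose sets vary with \<open>t\<close>, are then
      recognised as the same function.\<close>
    have "(\<lambda>(y, t). (if y \<le> t then ennreal (1 - cdf P t) else ennreal (cdf P t)))
        \<in> borel_measurable (Q \<Otimes>\<^sub>M lborel)" by measurable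
    moreover have "(\<lambda>(y, t). (if y \<le> t then ennreal (1 - cdf P t) else ennreal (cdf P t)))
        = (\<lambda>(y, t). indicator {..t} y * ennreal (1 - cdf P t)
                    + indicator {t<..} y * ennreal (cdf P t))"
      by (auto simp: fun_eq_iff)
    ultimately show "(\<lambda>(y, t). indicator {..t} y * ennreal (1 - cdf P t)
                    + indicator {t<..} y * ennreal (cdf P t))
        \<in> borel_measurable (Q \<Otimes>\<^sub>M lborel)" by simp
  qed
  also have "\<dots> = (\<integral>\<^sup>+t. cdf_cross P Q t \<partial>lborel)"
  proof (intro nn_integral_cong)
    fix t
    have "(\<integral>\<^sup>+y. indicator {..t} y * ennreal (1 - cdf P t)
              + indicator {t<..} y * ennreal (cdf P t) \<partial>Q)
        = ennreal (cdf Q t) * ennreal (1 - cdf P t)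
              + ennreal (1 - cdf Q t) * ennreal (cdf P t)"
      by (simp add: nn_integral_add nn_integral_multc sep[OF Q])
    also have "\<dots> = ennreal (cdf_cross P Q t)"
      using cdf_bounds[OF P, of t] cdf_bounds[OF Q, of t]
      by (simp add: cdf_cross_def add.commute mult.commute flip: ennreal_mult ennreal_plus)
    finally show "(\<integral>\<^sup>+y. indicator {..t} y * ennreal (1 - cdf P t)
              + indicator {t<..} y * ennreal (cdf P t) \<partial>Q) = ennreal (cdf_cross P Q t)" .
  qed
  finally show ?thesis by simp
qed

text \<open>The bound \<open>|x - y| \<le> |x| + |y|\<close> makes the iterated mean finite, so the
  identity of extended nonnegative integrals descends to real integrals.\<close>

lemma
  assumes P: "real_distribution P" and Q: "real_distribution Q"
    and iP: "integrable P (\<lambda>x. x)" and iQ: "integrable Q (\<lambda>x. x)"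
  shows integrable_cdf_cross: "integrable lborel (cdf_cross P Q)"
    and integrable_mean_abs_dist: "integrable Q (\<lambda>y. \<integral>x. \<bar>x - y\<bar> \<partial>P)"
    and mean_abs_diff_eq: "mean_abs_diff P Q = (\<integral>y. \<integral>x. \<bar>x - y\<bar> \<partial>P \<partial>Q)"
proof -
  interpret P: real_distribution P by fact
  interpret Q: real_distribution Q by fact
  have iP': "integrable P (\<lambda>x. \<bar>x - y\<bar>)" for y
    using iP by simp
  show iD: "integrable Q (\<lambda>y. \<integral>x. \<bar>x - y\<bar> \<partial>P)"
  proof (rule Bochner_Integration.integrable_bound)
    show "integrable Q (\<lambda>y. (\<integral>x. \<bar>x\<bar> \<partial>P) + \<bar>y\<bar>)" using iQ by simp
    show "(\<lambda>y. \<integral>x. \<bar>x - y\<bar> \<partial>P) \<in> borel_measurable Q" by measurable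
    show "AE y in Q. norm (\<integral>x. \<bar>x - y\<bar> \<partial>P) \<le> norm ((\<integral>x. \<bar>x\<bar> \<partial>P) + \<bar>y\<bar>)"
    proof (rule AE_I2)
      fix y
      have "(\<integral>x. \<bar>x - y\<bar> \<partial>P) \<le> (\<integral>x. \<bar>x\<bar> + \<bar>y\<bar> \<partial>P)"
        using iP iP' by (intro integral_mono) auto
      also have "\<dots> = (\<integral>x. \<bar>x\<bar> \<partial>P) + \<bar>y\<bar>"
        using iP P.prob_space by simp
      finally show "norm (\<integral>x. \<bar>x - y\<bar> \<partial>P) \<le> norm ((\<integral>x. \<bar>x\<bar> \<partial>P) + \<bar>y\<bar>)"
        by (simp add: integral_nonneg_AE)
    qed
  qed
  have "(\<integral>\<^sup>+t. cdf_cross P Q t \<partial>lborel) = (\<integral>\<^sup>+y. ennreal (\<integral>x. \<bar>x - y\<bar> \<partial>P) \<partial>Q)"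
    unfolding nn_integral_cdf_cross[OF P Q]
    by (intro nn_integral_cong nn_integral_eq_integral iP') auto
  also have "\<dots> = ennreal (\<integral>y. \<integral>x. \<bar>x - y\<bar> \<partial>P \<partial>Q)"
    by (intro nn_integral_eq_integral iD) (auto intro: integral_nonneg_AE)
  finally have "has_bochner_integral lborel (cdf_cross P Q) (\<integral>y. \<integral>x. \<bar>x - y\<bar> \<partial>P \<partial>Q)"
    using cdf_cross_nonneg[OF P Q] borel_measurable_cdf_cross[OF P Q]
    by (intro has_bochner_integral_nn_integral) (auto intro: integral_nonneg_AE)
  then show "integrable lborel (cdf_cross P Q)"
    "mean_abs_diff P Q = (\<integral>y. \<integral>x. \<bar>x - y\<bar> \<partial>P \<partial>Q)"
    unfolding mean_abs_diff_def by (auto simp: has_bochner_integral_iff)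
qed

section \<open>Score, entropy and divergence as mean absolute differences\<close>

lemma real_distribution_return: "real_distribution (return borel y)"
proof -
  interpret prob_space "return borel y" by (rule prob_space_return) simp
  show ?thesis by unfold_locales simp
qed

text \<open>The point mass at \<open>y\<close> has the indicator of \<open>y \<le> t\<close> as its
  distribution function, and half of \<open>cdf_cross P P\<close> is \<open>F (1 - F)\<close>. Hence
  the squared difference splits pointwise into two \<open>cdf_cross\<close> terms, each integrable
  by itself.\<close>

lemma crps_eq:
  assumes P: "real_distribution P" and iP: "integrable P (\<lambda>x. x)"
  shows "crps P y = (\<integral>x. \<bar>x - y\<bar> \<partial>P) - mean_abs_diff P P / 2"
proof -
  note Q = real_distribution_return[of y]
  have iQ: "integrable (return borel y) (\<lambda>x. x)"
    by (rule integrableI_bounded) (auto simp: nn_integral_return)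
  have "cdf (return borel y) t = indicator {y..} t" for t
    by (simp add: cdf_def measure_return indicator_def)
  then have "crps P y = (\<integral>t. cdf_cross P (return borel y) t - cdf_cross P P t / 2 \<partial>lborel)"
    unfolding crps_def cdf_cross_def
    by (intro Bochner_Integration.integral_cong)
       (auto simp: indicator_def power2_eq_square field_simps)
  also have "\<dots> = mean_abs_diff P (return borel y) - mean_abs_diff P P / 2"
    using integrable_cdf_cross[OF P Q iP iQ] integrable_cdf_cross[OF P P iP iP]
    by (simp add: mean_abs_diff_def)
  also have "mean_abs_diff P (return borel y) = (\<integral>x. \<bar>x - y\<bar> \<partial>P)"
  proof -
    interpret P: real_distribution P by fact
    show ?thesis
      unfolding mean_abs_diff_eq[OF P Q iP iQ] by (subst integral_return) auto
  qed
  finally show ?thesis .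
qed

lemma crps_score_eq:
  assumes P: "real_distribution P" and Q: "real_distribution Q"
    and iP: "integrable P (\<lambda>x. x)" and iQ: "integrable Q (\<lambda>x. x)"
  shows "crps_score P Q = mean_abs_diff P Q - mean_abs_diff P P / 2"
proof -
  interpret Q: real_distribution Q by fact
  show ?thesis
    unfolding crps_score_def crps_eq[OF P iP] mean_abs_diff_eq[OF P Q iP iQ]
    using integrable_mean_abs_dist[OF P Q iP iQ] Q.prob_space by simp
qed

lemma crps_entropy_eq:
  assumes "real_distribution P" and "integrable P (\<lambda>x. x)"
  shows "crps_entropy P = mean_abs_diff P P / 2"
  using crps_score_eq[OF assms(1,1,2,2)] by (simp add: crps_entropy_def)

text \<open>The right-hand side is half the energy distance
  \<open>2 E|X - Y| - E|X - X'| - E|Y - Y'|\<close>. All symmetry claims of the theorem come from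
  this form.\<close>

lemma crps_div_eq:
  assumes "real_distribution P" and "real_distribution Q"
    and "integrable P (\<lambda>x. x)" and "integrable Q (\<lambda>x. x)"
  shows "crps_div P Q = mean_abs_diff P Q - mean_abs_diff P P / 2 - mean_abs_diff Q Q / 2"
  using crps_score_eq[OF assms] crps_entropy_eq[OF assms(2,4)] by (simp add: crps_div_def)

section \<open>Mixtures\<close>

lemma cdf_mixture:
  assumes "M \<ge> 1" and P: "\<And>i. i \<in> {1..M} \<Longrightarrow> real_distribution (P i)"
  shows "cdf (mixture M P) t = (\<Sum>i=1..M. cdf (P i) t) / real M"
proof -
  have s: "sets (P i) = sets borel" if "i \<in> {1..M}" for i
    using real_distribution.events_eq_borel[OF P[OF that]] .
  have e: "emeasure (P i) {..t} = ennreal (cdf (P i) t)" if "i \<in> {1..M}" for i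
  proof -
    interpret real_distribution "P i" by (rule P[OF that])
    show ?thesis by (simp add: emeasure_eq_measure cdf_def)
  qed
  have "emeasure (mixture M P) {..t} = (\<Sum>i=1..M. emeasure (P i) {..t}) / of_nat M"
    using s by (intro emeasure_mixture) auto
  also have "\<dots> = (\<Sum>i=1..M. ennreal (cdf (P i) t)) / ennreal (real M)"
    using e by (simp add: ennreal_of_nat_eq_real_of_nat)
  also have "\<dots> = ennreal ((\<Sum>i=1..M. cdf (P i) t) / real M)"
    using cdf_bounds(1)[OF P] \<open>M \<ge> 1\<close>
    by (subst sum_ennreal) (auto intro!: divide_ennreal sum_nonneg)
  finally have "cdf (mixture M P) t = enn2real (ennreal ((\<Sum>i=1..M. cdf (P i) t) / real M))"
    by (simp add: cdf_def measure_def)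
  also have "\<dots> = (\<Sum>i=1..M. cdf (P i) t) / real M"
    using cdf_bounds(1)[OF P] by (intro enn2real_ennreal divide_nonneg_nonneg sum_nonneg) auto
  finally show ?thesis .
qed

text \<open>With \<open>F\<close> and \<open>G\<close> the distribution functions of the two
  arguments, \<open>cdf_cross\<close> equals \<open>F (1 - 2 G) + G\<close>, which is affine in
  \<open>F\<close>. The constant \<open>G\<close> survives averaging because the weights sum to
  1.\<close>

lemma cdf_cross_mixture:
  assumes "M \<ge> 1" and P: "\<And>i. i \<in> {1..M} \<Longrightarrow> real_distribution (P i)"
  shows "cdf_cross (mixture M P) Q = (\<lambda>t. (\<Sum>i=1..M. cdf_cross (P i) Q t) / real M)"
proof
  fix t
  have "(\<Sum>i=1..M. cdf_cross (P i) Q t)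
      = (\<Sum>i=1..M. cdf (P i) t * (1 - 2 * cdf Q t) + cdf Q t)"
    by (simp add: cdf_cross_def algebra_simps)
  also have "\<dots> = (\<Sum>i=1..M. cdf (P i) t) * (1 - 2 * cdf Q t) + real M * cdf Q t"
    by (simp only: sum.distrib sum_distrib_right) simp
  also have "(\<Sum>i=1..M. cdf (P i) t) = real M * cdf (mixture M P) t"
    using \<open>M \<ge> 1\<close> cdf_mixture[OF assms] by simp
  finally have "(\<Sum>i=1..M. cdf_cross (P i) Q t) = real M * cdf_cross (mixture M P) Q t"
    by (simp add: cdf_cross_def algebra_simps)
  then show "cdf_cross (mixture M P) Q t = (\<Sum>i=1..M. cdf_cross (P i) Q t) / real M"
    using \<open>M \<ge> 1\<close> by simp
qed

text \<open>Against the point mass at 0, \<open>cdf_cross\<close> integrates to \<open>E|X|\<close>.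
  For the mixture it is an average of finitely many integrable functions, so the first absolute
  moment is finite.\<close>

lemma integrable_mixture:
  assumes M: "M \<ge> 1" and P: "\<And>i. i \<in> {1..M} \<Longrightarrow> real_distribution (P i)"
    and iP: "\<And>i. i \<in> {1..M} \<Longrightarrow> integrable (P i) (\<lambda>x. x)"
  shows "integrable (mixture M P) (\<lambda>x. x)"
proof -
  note Q = real_distribution_return[of 0]
  have R: "real_distribution (mixture M P)"
    using M P by (rule real_distribution_mixture)
  interpret R: real_distribution "mixture M P" by (rule R)
  have iQ: "integrable (return borel 0) (\<lambda>x::real. x)"
    by (rule integrableI_bounded) (auto simp: nn_integral_return)
  have "integrable lborel (cdf_cross (P i) (return borel 0))" if "i \<in> {1..M}" for i
    using integrable_cdf_cross[OF P[OF that] Q iP[OF that] iQ] .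
  then have "integrable lborel (cdf_cross (mixture M P) (return borel 0))"
    using cdf_cross_mixture[of M P] M P
    by (auto intro!: integrable_divide integrable_sum)
  then have "(\<integral>\<^sup>+t. cdf_cross (mixture M P) (return borel 0) t \<partial>lborel) < \<infinity>"
    by (subst nn_integral_eq_integral) (auto intro: cdf_cross_nonneg[OF R Q])
  also have "(\<integral>\<^sup>+t. cdf_cross (mixture M P) (return borel 0) t \<partial>lborel)
      = (\<integral>\<^sup>+x. ennreal \<bar>x\<bar> \<partial>mixture M P)"
    unfolding nn_integral_cdf_cross[OF R Q] by (subst nn_integral_return) auto
  finally show ?thesis
    by (intro integrableI_bounded) auto
qed

lemma mean_abs_diff_mixture:
  assumes M: "M \<ge> 1" and P: "\<And>i. i \<in> {1..M} \<Longrightarrow> real_distribution (P i)"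
    and iP: "\<And>i. i \<in> {1..M} \<Longrightarrow> integrable (P i) (\<lambda>x. x)"
    and Q: "real_distribution Q" and iQ: "integrable Q (\<lambda>x. x)"
  shows "mean_abs_diff (mixture M P) Q = (\<Sum>i=1..M. mean_abs_diff (P i) Q) / real M"
proof -
  have "integrable lborel (cdf_cross (P i) Q)" if "i \<in> {1..M}" for i
    using integrable_cdf_cross[OF P[OF that] Q iP[OF that] iQ] .
  then show ?thesis
    using cdf_cross_mixture[of M P] M P by (simp add: mean_abs_diff_def integral_sum)
qed

section \<open>Gaussians\<close>

lemma gaussian_power2: "s > 0 \<Longrightarrow> gaussian m (s\<^sup>2) = density lborel (normal_density m s)"
  by (simp add: gaussian_def)

lemma integrable_gaussian:
  assumes "v > 0" shows "integrable (gaussian m v) (\<lambda>x. x)"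
  unfolding gaussian_def using integrable_normal_moment_nz_1[of "sqrt v" m] assms
  by (subst integrable_real_density) (auto simp: normal_density_nonneg)

text \<open>The negative of the standard normal density is an antiderivative of
  \<open>std_normal_density z * z\<close> and vanishes at minus infinity.\<close>

lemma integral_std_normal_below:
  "(\<integral>z. indicator {..<a} z * (std_normal_density z * z) \<partial>lborel) = - std_normal_density a"
proof -
  have int: "integrable lborel (\<lambda>z. std_normal_density z * z)"
    using integrable_std_normal_moment[of 1] by simp
  have cont: "isCont std_normal_density x" for x
    unfolding std_normal_density_def by (intro continuous_intros) auto
  have lim: "(std_normal_density \<longlongrightarrow> 0) at_bot"
    unfolding std_normal_density_def by real_asymp
  have "(LBINT z=-\<infinity>..ereal a. std_normal_density z * z) = - std_normal_density a - 0"
  proof (rule interval_integral_FTC_integrable)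
    fix x
    have "((\<lambda>z. - std_normal_density z) has_real_derivative std_normal_density x * x) (at x)"
      unfolding std_normal_density_def
      by (auto intro!: derivative_eq_intros simp: field_simps)
    then show "((\<lambda>z. - std_normal_density z) has_vector_derivative std_normal_density x * x) (at x)"
      by (simp add: has_real_derivative_iff_has_vector_derivative)
    show "isCont (\<lambda>z. std_normal_density z * z) x"
      by (intro continuous_intros cont)
  next
    show "set_integrable lborel (einterval (- \<infinity>) (ereal a)) (\<lambda>z. std_normal_density z * z)"
      unfolding set_integrable_def by (intro integrable_mult_indicator int) simp
    show "(((\<lambda>z. - std_normal_density z) \<circ> real_of_ereal) \<longlongrightarrow> 0) (at_right (- \<infinity>))"
      using tendsto_minus[OF lim] by (simp add: ereal_tendsto_simps)
    have "((\<lambda>z. - std_normal_density z) \<longlongrightarrow> - std_normal_density a) (at_left a)"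
      using cont[of a] unfolding isCont_def
      by (intro tendsto_minus) (auto intro: filterlim_mono[OF _ order_refl at_le])
    then show "(((\<lambda>z. - std_normal_density z) \<circ> real_of_ereal) \<longlongrightarrow> - std_normal_density a)
        (at_left (ereal a))"
      by (simp add: ereal_tendsto_simps)
  qed simp
  then show ?thesis
    by (simp add: interval_lebesgue_integral_le_eq set_lebesgue_integral_def)
qed

text \<open>Standardising by \<open>m - s z\<close> instead of \<open>m + s z\<close> turns the event that the
  variable is positive into \<open>z < m / s\<close>, so that no symmetry of \<open>\<Phi>\<close> is needed.\<close>

lemma integral_abs_gaussian:
  assumes s: "s > 0"
  shows "(\<integral>x. \<bar>x\<bar> \<partial>gaussian m (s\<^sup>2)) = A_crps m s"
proof -
  let ?N = "std_normal_distribution"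
  interpret N: real_distribution ?N by (rule real_dist_normal_dist)
  have "distributed ?N lborel (\<lambda>z. z) std_normal_density"
    by (auto simp: distributed_def distr_id2)
  from N.normal_density_affine[OF this, of "- s" m]
  have "distr ?N lborel (\<lambda>z. m - s * z) = gaussian m (s\<^sup>2)"
    using s by (simp add: distributed_def gaussian_power2)
  then have "(\<integral>x. \<bar>x\<bar> \<partial>gaussian m (s\<^sup>2)) = (\<integral>z. \<bar>m - s * z\<bar> \<partial>?N)"
    by (subst integral_distr[symmetric, where N=lborel]) auto
  also have "\<dots> = (\<integral>z. std_normal_density z * \<bar>m - s * z\<bar> \<partial>lborel)"
    by (subst integral_real_density) (auto simp: normal_density_nonneg)
  \<comment> \<open>This is \<open>|w| = 2 max(w, 0) - w\<close> for \<open>w = m - s * z\<close>: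
    truncated moments of orders 0 and 1, minus the full ones.\<close>
  also have "\<dots> = (\<integral>z. 2 * m * (indicator {..<m / s} z * std_normal_density z)
      - 2 * s * (indicator {..<m / s} z * (std_normal_density z * z))
      - m * std_normal_density z + s * (std_normal_density z * z) \<partial>lborel)"
  proof (intro Bochner_Integration.integral_cong refl)
    fix z
    have "z < m / s \<longleftrightarrow> s * z < m" using s by (simp add: field_simps)
    then show "std_normal_density z * \<bar>m - s * z\<bar>
      = 2 * m * (indicator {..<m / s} z * std_normal_density z)
        - 2 * s * (indicator {..<m / s} z * (std_normal_density z * z))
        - m * std_normal_density z + s * (std_normal_density z * z)"
      by (auto simp: indicator_def algebra_simps)
  qed
  also have "\<dots> = 2 * m * cdf ?N (m / s) + 2 * s * std_normal_density (m / s) - m"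
  proof -
    have int: "integrable lborel (\<lambda>z. std_normal_density z * z)"
      and int0: "integrable lborel std_normal_density"
      using integrable_std_normal_moment[of 1] by simp_all
    have i: "integrable lborel (\<lambda>z. indicator {..<m / s} z * (std_normal_density z * z))"
      "integrable lborel (\<lambda>z. indicator {..<m / s} z * std_normal_density z)"
      using integrable_mult_indicator[OF _ int, of "{..<m / s}"]
        integrable_mult_indicator[OF _ int0, of "{..<m / s}"] by auto
    have "cdf ?N (m / s) = (\<integral>z. indicator {..m / s} z \<partial>?N)"
      by (simp add: cdf_def)
    also have "\<dots> = (\<integral>z. std_normal_density z * indicator {..m / s} z \<partial>lborel)"
      by (subst integral_real_density) (auto simp: normal_density_nonneg)
    \<comment> \<open>The distribution function uses a closed half-line, the truncation an open one;
      the endpoint is a null set.\<close>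
    also have "\<dots> = (\<integral>z. indicator {..<m / s} z * std_normal_density z \<partial>lborel)"
      by (rule integral_cong_AE, measurable, use AE_lborel_singleton[of "m / s"] in eventually_elim)
         (auto simp: indicator_def)
    finally show ?thesis
      using i int int0 integral_std_normal_below[of "m / s"] integral_std_normal_moment_odd[of 0]
      by simp
  qed
  also have "\<dots> = A_crps m s" by (simp add: A_crps_def algebra_simps)
  finally show ?thesis .
qed

text \<open>On the product space the coordinates are independent, so their difference is Gaussian
  with mean \<open>m - n\<close> and variance \<open>s\<^sup>2 + t\<^sup>2\<close>, and its mean
  absolute value is known.\<close>

lemma mean_abs_diff_gaussian:
  assumes s: "s > 0" and t: "t > 0"
  shows "mean_abs_diff (gaussian m (s\<^sup>2)) (gaussian n (t\<^sup>2)) = A_crps (m - n) (sqrt (s\<^sup>2 + t\<^sup>2))"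
proof -
  let ?P = "gaussian m (s\<^sup>2)" and ?Q = "gaussian n (t\<^sup>2)"
  have P: "real_distribution ?P" and Q: "real_distribution ?Q"
    using s t by (auto intro: real_distribution_gaussian)
  interpret P: real_distribution ?P by (rule P)
  interpret Q: real_distribution ?Q by (rule Q)
  interpret PQ: pair_prob_space ?P ?Q ..
  have iP: "integrable ?P (\<lambda>x. x)" and iQ: "integrable ?Q (\<lambda>x. x)"
    using s t by (auto intro: integrable_gaussian)
  have d1: "distr (?P \<Otimes>\<^sub>M ?Q) borel fst = ?P"
    using Q.distr_pair_fst[of ?P] by (simp cong: distr_cong)
  have d2: "distr (?P \<Otimes>\<^sub>M ?Q) borel snd = ?Q"
  proof (rule measure_eqI)
    fix A assume "A \<in> sets (distr (?P \<Otimes>\<^sub>M ?Q) borel snd)"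
    moreover then have "snd -` A \<inter> space (?P \<Otimes>\<^sub>M ?Q) = space ?P \<times> A"
      by (auto simp: space_pair_measure)
    ultimately show "emeasure (distr (?P \<Otimes>\<^sub>M ?Q) borel snd) A = emeasure ?Q A"
      using P.emeasure_space_1 by (simp add: emeasure_distr Q.emeasure_pair_measure_Times)
  qed simp
  \<comment> \<open>The joint law of the two coordinates is the law of the identity map, hence the
    product of the marginals; this is independence.\<close>
  have "?P \<Otimes>\<^sub>M ?Q = distr (?P \<Otimes>\<^sub>M ?Q) (borel \<Otimes>\<^sub>M borel) (\<lambda>x. (fst x, snd x))"
    unfolding prod.collapse
    by (rule distr_id2[symmetric]) (intro sets_pair_measure_cong sets_gaussian[symmetric])
  then have indep: "PQ.indep_var borel fst borel snd"
    unfolding PQ.indep_var_distribution_eq d1 d2 by simp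
  \<comment> \<open>Densities refer to \<open>lborel\<close>, independence to \<open>borel\<close>.
    Both have the same sets, and a push-forward depends on its target only through them.\<close>
  have lb: "distr (?P \<Otimes>\<^sub>M ?Q) lborel f = distr (?P \<Otimes>\<^sub>M ?Q) borel f" for f :: "real \<times> real \<Rightarrow> real"
    by (rule distr_cong) simp_all
  have "distributed (?P \<Otimes>\<^sub>M ?Q) lborel fst (normal_density m s)"
    using trans[OF lb d1] gaussian_power2[OF s] by (auto simp: distributed_def)
  moreover have "distributed (?P \<Otimes>\<^sub>M ?Q) lborel snd (normal_density n t)"
    using trans[OF lb d2] gaussian_power2[OF t] by (auto simp: distributed_def)
  ultimately have "distributed (?P \<Otimes>\<^sub>M ?Q) lborel (\<lambda>x. fst x - snd x)
      (normal_density (m - n) (sqrt (s\<^sup>2 + t\<^sup>2)))"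
    by (rule PQ.diff_indep_normal[OF indep s t])
  then have D: "distr (?P \<Otimes>\<^sub>M ?Q) lborel (\<lambda>x. fst x - snd x) = gaussian (m - n) ((sqrt (s\<^sup>2 + t\<^sup>2))\<^sup>2)"
    using s t by (simp add: distributed_def gaussian_def)
  \<comment> \<open>In extended nonnegative integrals, the iterated mean becomes one integral over
    the product and is then pushed forward along the difference.\<close>
  have "ennreal (mean_abs_diff ?P ?Q) = (\<integral>\<^sup>+t. cdf_cross ?P ?Q t \<partial>lborel)"
    unfolding mean_abs_diff_def
    by (intro nn_integral_eq_integral[symmetric] integrable_cdf_cross P Q iP iQ)
       (auto intro: cdf_cross_nonneg P Q)
  also have "\<dots> = (\<integral>\<^sup>+x. ennreal \<bar>fst x - snd x\<bar> \<partial>(?P \<Otimes>\<^sub>M ?Q))"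
    unfolding nn_integral_cdf_cross[OF P Q]
    by (subst PQ.nn_integral_snd[symmetric]) auto
  also have "\<dots> = (\<integral>\<^sup>+x. ennreal \<bar>x\<bar> \<partial>gaussian (m - n) ((sqrt (s\<^sup>2 + t\<^sup>2))\<^sup>2))"
    unfolding D[symmetric] by (subst nn_integral_distr) auto
  also have "\<dots> = ennreal (\<integral>x. \<bar>x\<bar> \<partial>gaussian (m - n) ((sqrt (s\<^sup>2 + t\<^sup>2))\<^sup>2))"
    using s t by (intro nn_integral_eq_integral integrable_abs integrable_gaussian)
      (auto simp: add_pos_pos)
  finally have "mean_abs_diff ?P ?Q = (\<integral>x. \<bar>x\<bar> \<partial>gaussian (m - n) ((sqrt (s\<^sup>2 + t\<^sup>2))\<^sup>2))"
    by (subst (asm) ennreal_inj)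
       (auto simp: mean_abs_diff_def intro!: integral_nonneg_AE cdf_cross_nonneg P Q)
  also have "\<dots> = A_crps (m - n) (sqrt (s\<^sup>2 + t\<^sup>2))"
    using s t by (intro integral_abs_gaussian) (simp add: add_pos_pos)
  finally show ?thesis .
qed

text \<open>For two independent copies the means cancel, leaving \<open>2 * sqrt 2 * s\<close> times
  the peak \<open>1 / sqrt (2 * pi)\<close> of the density. Half of the result is the Gaussian
  entropy.\<close>

lemma A_crps_0_diag:
  assumes "s > 0" shows "A_crps 0 (sqrt (s\<^sup>2 + s\<^sup>2)) = 2 * s / sqrt pi"
proof -
  have "sqrt (s\<^sup>2 + s\<^sup>2) = sqrt 2 * s"
    using assms by (simp add: real_sqrt_mult flip: mult_2)
  then show ?thesis
    by (simp add: A_crps_def std_normal_density_def real_sqrt_mult field_simps)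
qed

section \<open>Bayes risks and excess risks of the ensemble\<close>

theorem mainTheorem1:
  fixes M :: nat and \<mu> \<sigma> :: "nat \<Rightarrow> real"
    and P :: "nat \<Rightarrow> real measure" and P_ens P_star :: "real measure"
    and \<mu>_star var_star \<sigma>_star :: real
  assumes "M \<ge> 1"
    and "\<And>i. i \<in> {1..M} \<Longrightarrow> \<sigma> i > 0"
    and "\<And>i. i \<in> {1..M} \<Longrightarrow> P i = gaussian (\<mu> i) ((\<sigma> i)\<^sup>2)"
    and "P_ens = mixture M P"
    and "\<mu>_star = (1 / real M) * (\<Sum>i=1..M. \<mu> i)"
    and "var_star = (1 / real M) * (\<Sum>i=1..M. (\<sigma> i)\<^sup>2 + (\<mu> i)\<^sup>2) - \<mu>_star\<^sup>2"
    and "\<sigma>_star = sqrt var_star"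
    and "P_star = gaussian \<mu>_star var_star"
  shows
    "(1 / real M) * (\<Sum>i=1..M. crps_entropy (P i)) = 1 / (real M * sqrt pi) * (\<Sum>i=1..M. \<sigma> i)
   \<and> crps_entropy P_ens
       = 1 / (2 * (real M)\<^sup>2)
         * (\<Sum>i=1..M. \<Sum>j=1..M. A_crps (\<mu> i - \<mu> j) (sqrt ((\<sigma> i)\<^sup>2 + (\<sigma> j)\<^sup>2)))
   \<and> crps_entropy P_star = sqrt (var_star / pi)
   \<and> (1 / (real M)\<^sup>2) * (\<Sum>i=1..M. \<Sum>j=1..M. crps_div (P i) (P j))
       = (1 / (real M)\<^sup>2)
         * (\<Sum>i=1..M. \<Sum>j=1..M. A_crps (\<mu> i - \<mu> j) (sqrt ((\<sigma> i)\<^sup>2 + (\<sigma> j)\<^sup>2))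
                               - (\<sigma> i + \<sigma> j) / sqrt pi)
   \<and> (1 / real M) * (\<Sum>i=1..M. crps_div P_ens (P i)) = (1 / real M) * (\<Sum>i=1..M. crps_div (P i) P_ens)
   \<and> (1 / real M) * (\<Sum>i=1..M. crps_div (P i) P_ens)
       = 1 / (2 * (real M)\<^sup>2)
         * (\<Sum>i=1..M. \<Sum>j=1..M. A_crps (\<mu> i - \<mu> j) (sqrt ((\<sigma> i)\<^sup>2 + (\<sigma> j)\<^sup>2)))
         - (1 / real M) * (\<Sum>i=1..M. \<sigma> i / sqrt pi)
   \<and> (1 / real M) * (\<Sum>j=1..M. crps_div P_star (P j)) = (1 / real M) * (\<Sum>j=1..M. crps_div (P j) P_star)
   \<and> (1 / real M) * (\<Sum>j=1..M. crps_div (P j) P_star)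
       = (1 / real M)
         * (\<Sum>j=1..M. A_crps (\<mu>_star - \<mu> j) (sqrt (\<sigma>_star\<^sup>2 + (\<sigma> j)\<^sup>2))
                    - (\<sigma>_star + \<sigma> j) / sqrt pi)
   \<and> crps_div P_star P_ens = crps_div P_ens P_star
   \<and> crps_div P_ens P_star
       = (1 / real M) * (\<Sum>j=1..M. A_crps (\<mu>_star - \<mu> j) (sqrt (\<sigma>_star\<^sup>2 + (\<sigma> j)\<^sup>2)))
         - \<sigma>_star / sqrt pi - crps_entropy P_ens
   \<and> 2 * ((1 / real M) * (\<Sum>i=1..M. crps_div P_ens (P i)))
       = (1 / (real M)\<^sup>2) * (\<Sum>i=1..M. \<Sum>j=1..M. crps_div (P i) (P j))"
proof -
  define a where "a i j = A_crps (\<mu> i - \<mu> j) (sqrt ((\<sigma> i)\<^sup>2 + (\<sigma> j)\<^sup>2))" for i j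
  define b where "b j = A_crps (\<mu>_star - \<mu> j) (sqrt (\<sigma>_star\<^sup>2 + (\<sigma> j)\<^sup>2))" for j
  define m where "m = real M"
  have m: "m > 0" using \<open>M \<ge> 1\<close> by (simp add: m_def)
  \<comment> \<open>The variance is given as a difference. Centring the means at
    \<open>\<mu>_star\<close> turns it into a sum of squares, positive since
    \<open>M \<ge> 1\<close> and all \<open>\<sigma> i > 0\<close>; so \<open>P_star\<close> is a
    genuine Gaussian.\<close>
  have "var_star = (1 / m) * (\<Sum>i=1..M. (\<sigma> i)\<^sup>2 + (\<mu> i - \<mu>_star)\<^sup>2)"
  proof -
    have "(\<Sum>i=1..M. (\<sigma> i)\<^sup>2 + (\<mu> i - \<mu>_star)\<^sup>2)
        = (\<Sum>i=1..M. ((\<sigma> i)\<^sup>2 + (\<mu> i)\<^sup>2) - 2 * \<mu>_star * \<mu> i + \<mu>_star\<^sup>2)"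
      by (simp add: power2_diff algebra_simps)
    also have "\<dots> = (\<Sum>i=1..M. (\<sigma> i)\<^sup>2 + (\<mu> i)\<^sup>2) - 2 * \<mu>_star * (\<Sum>i=1..M. \<mu> i) + m * \<mu>_star\<^sup>2"
      unfolding sum.distrib[of _ "\<lambda>_. \<mu>_star\<^sup>2"] sum_subtractf sum_distrib_left[symmetric]
      by (simp add: m_def)
    also have "(\<Sum>i=1..M. \<mu> i) = m * \<mu>_star" using m assms(5) by (simp add: m_def)
    finally show ?thesis
      unfolding assms(6) m_def[symmetric] using m by (simp add: field_simps power2_eq_square)
  qed
  moreover have "(\<Sum>i=1..M. (\<sigma> i)\<^sup>2 + (\<mu> i - \<mu>_star)\<^sup>2) > 0"
    using assms(1,2) by (intro sum_pos) (auto intro!: add_pos_nonneg zero_less_power)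
  ultimately have var_pos: "var_star > 0" using m by simp
  then have star_pos: "\<sigma>_star > 0" and star: "P_star = gaussian \<mu>_star (\<sigma>_star\<^sup>2)"
    using assms(7,8) by simp_all
  have P: "real_distribution (P i)" "integrable (P i) (\<lambda>x. x)" if "i \<in> {1..M}" for i
    using assms(2)[OF that] unfolding assms(3)[OF that]
    by (simp_all add: real_distribution_gaussian integrable_gaussian)
  have S: "real_distribution P_star" "integrable P_star (\<lambda>x. x)"
    using var_pos unfolding assms(8) by (simp_all add: real_distribution_gaussian integrable_gaussian)
  have E: "real_distribution P_ens" "integrable P_ens (\<lambda>x. x)"
    unfolding assms(4) using real_distribution_mixture[of M P] integrable_mixture[of M P] assms(1) P
    by blast+
  have PP: "mean_abs_diff (P i) (P j) = a i j" if "i \<in> {1..M}" "j \<in> {1..M}" for i j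
    using assms(2)[OF that(1)] assms(2)[OF that(2)]
    unfolding a_def assms(3)[OF that(1)] assms(3)[OF that(2)] by (rule mean_abs_diff_gaussian)
  have SP: "mean_abs_diff P_star (P j) = b j" if "j \<in> {1..M}" for j
    using star_pos assms(2)[OF that]
    unfolding b_def star assms(3)[OF that] by (rule mean_abs_diff_gaussian)
  have SS: "mean_abs_diff P_star P_star = 2 * \<sigma>_star / sqrt pi"
    using mean_abs_diff_gaussian[OF star_pos star_pos, of \<mu>_star \<mu>_star] A_crps_0_diag[OF star_pos]
    by (simp add: star)
  have diag: "a i i = 2 * \<sigma> i / sqrt pi" if "i \<in> {1..M}" for i
    using A_crps_0_diag[OF assms(2)[OF that]] by (simp add: a_def)
  have mix: "mean_abs_diff P_ens Q = (\<Sum>i=1..M. mean_abs_diff (P i) Q) / m"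
    if "real_distribution Q" "integrable Q (\<lambda>x. x)" for Q
    unfolding assms(4) m_def using mean_abs_diff_mixture[of M P Q] assms(1) P that by blast
  have EP: "mean_abs_diff P_ens (P j) = (\<Sum>i=1..M. a i j) / m" if "j \<in> {1..M}" for j
    using mix[OF P[OF that]] PP that by simp
  have ES: "mean_abs_diff P_ens P_star = (\<Sum>j=1..M. b j) / m"
    using mix[OF S] SP by (simp add: mean_abs_diff_commute[of _ P_star])
  \<comment> \<open>Mixing is applied to the first argument and then, by symmetry, to the second.
    The indices come out transposed, which exchanging the sums repairs.\<close>
  have EE: "mean_abs_diff P_ens P_ens = (\<Sum>i=1..M. \<Sum>j=1..M. a i j) / m\<^sup>2"
  proof -
    have "mean_abs_diff P_ens P_ens = (\<Sum>i=1..M. (\<Sum>j=1..M. a j i) / m) / m"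
      unfolding mix[OF E]
      by (intro arg_cong[of _ _ "\<lambda>x. x / m"] sum.cong refl)
         (metis EP mean_abs_diff_commute)
    also have "\<dots> = (\<Sum>i=1..M. \<Sum>j=1..M. a j i) / m\<^sup>2"
      by (simp add: sum_divide_distrib power2_eq_square)
    also have "(\<Sum>i=1..M. \<Sum>j=1..M. a j i) = (\<Sum>i=1..M. \<Sum>j=1..M. a i j)"
      by (rule sum.swap)
    finally show ?thesis .
  qed
  have HP: "crps_entropy (P i) = \<sigma> i / sqrt pi" if "i \<in> {1..M}" for i
    using crps_entropy_eq[OF P[OF that]] PP[OF that that] diag[OF that] by simp
  have HE: "crps_entropy P_ens = 1 / (2 * m\<^sup>2) * (\<Sum>i=1..M. \<Sum>j=1..M. a i j)"
    using crps_entropy_eq[OF E] EE by simp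
  have HS: "crps_entropy P_star = sqrt (var_star / pi)"
    using crps_entropy_eq[OF S] SS assms(7) by (simp add: real_sqrt_divide)
  have dPP: "crps_div (P i) (P j) = a i j - (\<sigma> i + \<sigma> j) / sqrt pi"
    if "i \<in> {1..M}" "j \<in> {1..M}" for i j
    using crps_div_eq[OF P(1)[OF that(1)] P(1)[OF that(2)] P(2)[OF that(1)] P(2)[OF that(2)]]
      PP that diag by (simp add: add_divide_distrib)
  \<comment> \<open>With this, each equality of the theorem that swaps prediction and truth holds
    term by term.\<close>
  have sym: "crps_div Q R = crps_div R Q"
    if "real_distribution Q" "integrable Q (\<lambda>x. x)" "real_distribution R" "integrable R (\<lambda>x. x)" for Q R
    using that by (simp add: crps_div_eq mean_abs_diff_commute[of Q R])
  have dPE: "crps_div P_ens (P i) = crps_div (P i) P_ens" if "i \<in> {1..M}" for i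
    by (intro sym E P that)
  have dPS: "crps_div P_star (P i) = crps_div (P i) P_star" if "i \<in> {1..M}" for i
    by (intro sym S P that)
  have dSE: "crps_div P_star P_ens = crps_div P_ens P_star"
    by (intro sym S E)
  have sPE: "(1 / m) * (\<Sum>i=1..M. crps_div (P i) P_ens)
      = 1 / (2 * m\<^sup>2) * (\<Sum>i=1..M. \<Sum>j=1..M. a i j) - (1 / m) * (\<Sum>i=1..M. \<sigma> i / sqrt pi)"
  proof -
    \<comment> \<open>\<open>?H\<close> is \<open>E|X - X'|\<close> for the ensemble. The cross
      terms average to \<open>?H\<close> and each divergence subtracts \<open>?H / 2\<close>, so one
      half of it remains.\<close>
    let ?H = "(\<Sum>i=1..M. \<Sum>j=1..M. a i j) / m\<^sup>2"
    have "crps_div (P i) P_ens = (\<Sum>j=1..M. a j i) / m - \<sigma> i / sqrt pi - ?H / 2" if "i \<in> {1..M}" for i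
      using crps_div_eq[OF E(1) P(1)[OF that] E(2) P(2)[OF that]] EE EP PP diag that dPE by simp
    then have "(\<Sum>i=1..M. crps_div (P i) P_ens)
        = (\<Sum>i=1..M. (\<Sum>j=1..M. a j i) / m - \<sigma> i / sqrt pi - ?H / 2)"
      by (intro sum.cong) auto
    also have "\<dots> = (\<Sum>i=1..M. \<Sum>j=1..M. a j i) / m - (\<Sum>i=1..M. \<sigma> i / sqrt pi) - m * (?H / 2)"
      by (simp add: sum_subtractf sum_divide_distrib m_def)
    also have "(\<Sum>i=1..M. \<Sum>j=1..M. a j i) = (\<Sum>i=1..M. \<Sum>j=1..M. a i j)"
      by (rule sum.swap)
    finally have s: "(\<Sum>i=1..M. crps_div (P i) P_ens)
        = (\<Sum>i=1..M. \<Sum>j=1..M. a i j) / m - (\<Sum>i=1..M. \<sigma> i / sqrt pi) - m * (?H / 2)" .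
    \<comment> \<open>With \<open>X\<close> and \<open>Y\<close> arbitrary, the algebra leaves the
      sums intact.\<close>
    have "(1 / m) * (X / m - Y - m * (X / m\<^sup>2 / 2)) = 1 / (2 * m\<^sup>2) * X - (1 / m) * Y" for X Y
      using m by (simp add: field_simps power2_eq_square)
    with s show ?thesis by simp
  qed
  have sPP: "(\<Sum>i=1..M. \<Sum>j=1..M. crps_div (P i) (P j))
      = (\<Sum>i=1..M. \<Sum>j=1..M. a i j - (\<sigma> i + \<sigma> j) / sqrt pi)"
    using dPP by (intro sum.cong refl) auto
  \<comment> \<open>Each \<open>\<sigma> i\<close> occurs \<open>M\<close> times as a row term and
    \<open>M\<close> times as a column term, hence the factor \<open>2 * m\<close>.\<close>
  have sPP': "(\<Sum>i=1..M. \<Sum>j=1..M. crps_div (P i) (P j))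
      = (\<Sum>i=1..M. \<Sum>j=1..M. a i j) - 2 * m * (\<Sum>i=1..M. \<sigma> i / sqrt pi)"
    unfolding sPP
    by (simp add: sum_subtractf sum.distrib add_divide_distrib m_def sum_distrib_left mult.assoc)
  have sPS: "(\<Sum>j=1..M. crps_div (P j) P_star) = (\<Sum>j=1..M. b j - (\<sigma>_star + \<sigma> j) / sqrt pi)"
  proof (intro sum.cong refl)
    fix j assume j: "j \<in> {1..M}"
    show "crps_div (P j) P_star = b j - (\<sigma>_star + \<sigma> j) / sqrt pi"
      using crps_div_eq[OF S(1) P(1)[OF j] S(2) P(2)[OF j]] SS SP[OF j] PP[OF j j] diag[OF j] dPS[OF j]
      by (simp add: add_divide_distrib)
  qed
  have dES: "crps_div P_ens P_star = (1 / m) * (\<Sum>j=1..M. b j) - \<sigma>_star / sqrt pi - crps_entropy P_ens"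
    using crps_div_eq[OF E(1) S(1) E(2) S(2)] ES SS crps_entropy_eq[OF E] by simp
  have ind: "2 * ((1 / m) * (\<Sum>i=1..M. crps_div (P i) P_ens))
       = (1 / m\<^sup>2) * (\<Sum>i=1..M. \<Sum>j=1..M. crps_div (P i) (P j))"
    unfolding sPE sPP' using m by (simp add: field_simps power2_eq_square)
  have c1: "(1 / m) * (\<Sum>i=1..M. crps_entropy (P i)) = 1 / (m * sqrt pi) * (\<Sum>i=1..M. \<sigma> i)"
    using HP by (simp flip: sum_divide_distrib)
  have c2: "(\<Sum>i=1..M. crps_div P_ens (P i)) = (\<Sum>i=1..M. crps_div (P i) P_ens)"
    "(\<Sum>j=1..M. crps_div P_star (P j)) = (\<Sum>j=1..M. crps_div (P j) P_star)"
    using dPE dPS by (auto intro: sum.cong)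
  \<comment> \<open>Rewriting with \<open>c2\<close> puts \<open>P_ens\<close> and
    \<open>P_star\<close> in the second argument throughout the averaged sums, so two symmetry
    claims become reflexivity and the final identity becomes \<open>ind\<close>.\<close>
  show ?thesis
    unfolding m_def[symmetric] a_def[symmetric] b_def[symmetric] c2
    by (intro conjI refl c1 HE HS sPE dSE dES ind) (simp_all only: sPP sPS)
qed

end
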